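(* Let $m \ge 1$ and $n \ge 1$ be integers, and let $P(X_1,\ldots,X_n) \in \mathbb{R}[X_1,\ldots,X_n]$ be any polynomial (of arbitrary degree) that sign represents the parity function over $\{1,2,\ldots,m\}^n$. Then the sparsity of $P$ is at least $n(m-1)+1$.
   Context: For $A \subseteq \mathbb{Z}$, the parity function $\mathrm{Par}: A^n \to \{0,1\}$ is $\mathrm{Par}(a_1,\ldots,a_n) = \sum_{i=1}^n a_i \bmod 2$. A polynomial $P$ sign represents $f: A^n \to \{0,1\}$ if for every $a \in A^n$: $f(a) = 0 \Rightarrow P(a) > 0$ and $f(a) = 1 \Rightarrow P(a) < 0$. The sparsity of $P$ is the number of monomials with nonzero coefficient in the standard monomial basis. *)

theory Defs
  imports Complex_Main "HOL-Library.Poly_Mapping" "HOL-Library.FuncSet"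
begin

text \<open>A monomial is its finitely supported exponent vector, and a polynomial is the finitely
  supported map from monomials to coefficients. The variables are indexed by all of nat, so
  \<open>poly_ring n\<close> carves out the polynomials in \<open>X\<^sub>1, \<dots>, X\<^sub>n\<close>.\<close>

type_synonym rmpoly = "(nat \<Rightarrow>\<^sub>0 nat) \<Rightarrow>\<^sub>0 real"

definition poly_ring :: "nat \<Rightarrow> rmpoly set" where
  "poly_ring n = {P. \<forall>\<mu> \<in> Poly_Mapping.keys P. Poly_Mapping.keys \<mu> \<subseteq> {1..n}}"

definition monom_eval :: "(nat \<Rightarrow>\<^sub>0 nat) \<Rightarrow> (nat \<Rightarrow> real) \<Rightarrow> real" where
  "monom_eval \<mu> x = (\<Prod>i \<in> Poly_Mapping.keys \<mu>. x i ^ Poly_Mapping.lookup \<mu> i)"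

definition mpoly_eval :: "rmpoly \<Rightarrow> (nat \<Rightarrow> real) \<Rightarrow> real" where
  "mpoly_eval P x =
     (\<Sum>\<mu> \<in> Poly_Mapping.keys P. Poly_Mapping.lookup P \<mu> * monom_eval \<mu> x)"

definition sparsity :: "rmpoly \<Rightarrow> nat" where
  "sparsity P = card (Poly_Mapping.keys P)"

definition cube :: "int set \<Rightarrow> nat \<Rightarrow> (nat \<Rightarrow> int) set" where
  "cube A n = {1..n} \<rightarrow>\<^sub>E A"

definition Par :: "nat \<Rightarrow> (nat \<Rightarrow> int) \<Rightarrow> int" where
  "Par n a = (\<Sum>i = 1..n. a i) mod 2"

definition sign_represents :: "rmpoly \<Rightarrow> int set \<Rightarrow> nat \<Rightarrow> ((nat \<Rightarrow> int) \<Rightarrow> int) \<Rightarrow> bool" where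
  "sign_represents P A n f \<longleftrightarrow>
     (\<forall>a \<in> cube A n.
        (f a = 0 \<longrightarrow> mpoly_eval P (\<lambda>i. real_of_int (a i)) > 0) \<and>
        (f a = 1 \<longrightarrow> mpoly_eval P (\<lambda>i. real_of_int (a i)) < 0))"

end

theory Submission imports Defs begin

text \<open>
  Induction on \<open>n\<close>. Splitting off the last coordinate \<open>b\<close>, the signs of \<open>P(a, b)\<close> alternate in
  \<open>b\<close>, so for positive weights \<open>w\<^sub>b\<close> the polynomial \<open>\<Sum>\<^sub>b (-1)\<^sup>b w\<^sub>b P(X, b)\<close> sign represents parity in
  one variable less. A monomial containing \<open>X\<^sub>n\<^sup>e\<close> is multiplied by \<open>\<Sum>\<^sub>b (-1)\<^sup>b w\<^sub>b b\<^sup>e\<close>, and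
  the weights can be chosen so that this vanishes at any \<open>m - 1\<close> prescribed exponents \<open>e\<close>. Hence
  at least \<open>m - 1\<close> monomials disappear.

  The weights are built one exponent at a time by combining solutions on two overlapping windows.
  That the combination has positive coefficients is a sign condition, which follows from
  the fact that a real exponential sum with \<open>N\<close> terms has at most \<open>N - 1\<close> zeros.
\<close>

text \<open>Rolle's theorem gives a zero of \<open>f'\<close> between any two consecutive points of
  \<open>Z\<close>. The clause \<open>z < Max Z\<close> strengthens the induction: it puts the new
  zero strictly to the right of those found before.\<close>

lemma Rolle_zeros:
  fixes f f' :: "real \<Rightarrow> real"
  assumes "finite Z" "Z \<noteq> {}" "\<forall>z\<in>Z. f z = 0"
    and deriv: "\<And>x. (f has_real_derivative f' x) (at x)"
  shows "\<exists>Z'. finite Z' \<and> card Z' = card Z - 1 \<and> (\<forall>z\<in>Z'. z < Max Z \<and> f' z = 0)"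
  using assms(1-3)
proof (induction Z rule: finite_linorder_max_induct)
  case empty
  then show ?case by simp
next
  case (insert b A)
  show ?case
  proof (cases "A = {}")
    case True
    then show ?thesis by (intro exI[of _ "{}"]) simp
  next
    case False
    obtain Z' where Z': "finite Z'" "card Z' = card A - 1" "\<forall>z\<in>Z'. z < Max A \<and> f' z = 0"
      using insert.IH False insert.prems by auto
    have Max_less: "Max A < b" using insert False by simp
    have "Max A \<in> A" using insert False by simp
    then have "f (Max A) = f b" using insert.prems by simp
    then obtain z where z: "Max A < z" "z < b" "f' z = 0"
      using Rolle_deriv[OF Max_less, of f "\<lambda>x v. f' x * v"] deriv
      by (metis (no_types, lifting) DERIV_continuous_on DERIV_subset has_field_derivative_def
          mult.right_neutral subset_UNIV)
    have "z \<notin> Z'" using Z' z by force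
    moreover have "Max (insert b A) = b"
      using insert by (intro Max_eqI) (auto intro: less_imp_le)
    moreover have "card A > 0" "b \<notin> A"
      using insert False by (auto simp: card_gt_0_iff)
    ultimately show ?thesis using Z' z Max_less insert(1)
      by (intro exI[of _ "insert z Z'"]) auto
  qed
qed

text \<open>Dividing by one exponential turns its term into a constant, and differentiation then
  removes it. By Rolle this costs one zero, so the induction loses one term and one zero at a
  time.\<close>

lemma exp_sum_zeros:
  fixes l c :: "'a \<Rightarrow> real"
  assumes "finite I" "inj_on l I" "finite Z" "card I \<le> card Z"
    and "\<forall>t\<in>Z. (\<Sum>i\<in>I. c i * exp (l i * t)) = 0"
  shows "\<forall>i\<in>I. c i = 0"
  using assms
proof (induction I arbitrary: c Z rule: finite_induct)
  case empty
  then show ?case by simp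
next
  case (insert j I)
  define g where "g t = (\<Sum>i\<in>insert j I. c i * exp ((l i - l j) * t))" for t
  define g' where "g' t = (\<Sum>i\<in>insert j I. c i * (l i - l j) * exp ((l i - l j) * t))" for t
  have scale: "exp ((l i - l j) * t) = exp (l i * t) * exp (- (l j * t))" for i t
    by (simp add: exp_add[symmetric] algebra_simps)
  have Z_ne: "Z \<noteq> {}" using insert by auto
  have "g t = exp (- (l j * t)) * (\<Sum>i\<in>insert j I. c i * exp (l i * t))" for t
    unfolding g_def sum_distrib_left by (intro sum.cong) (auto simp: scale)
  then have g0: "\<forall>t\<in>Z. g t = 0" using insert.prems by simp
  have deriv: "(g has_real_derivative g' t) (at t)" for t
    unfolding g_def g'_def
    by (rule DERIV_cong, (rule derivative_intros)+) (auto intro!: sum.cong)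
  obtain Z' where Z': "finite Z'" "card Z' = card Z - 1" "\<forall>t\<in>Z'. g' t = 0"
    using Rolle_zeros[OF insert.prems(2) Z_ne g0 deriv] by blast
  have g'_eq: "g' t = exp (- (l j * t)) * (\<Sum>i\<in>I. (c i * (l i - l j)) * exp (l i * t))" for t
    unfolding g'_def sum_distrib_left using insert(1,2)
    by (auto simp: scale intro!: sum.cong)
  have "\<forall>i\<in>I. c i * (l i - l j) = 0"
  proof (rule insert.IH)
    show "inj_on l I" using insert.prems by simp
    show "card I \<le> card Z'" using insert Z' by simp
    show "\<forall>t\<in>Z'. (\<Sum>i\<in>I. c i * (l i - l j) * exp (l i * t)) = 0"
      using Z'(3) by (simp add: g'_eq)
  qed (fact Z')
  moreover have "l i \<noteq> l j" if "i \<in> I" for i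
    using inj_onD[OF insert.prems(1), of i j] insert(2) that by auto
  ultimately have c0: "\<forall>i\<in>I. c i = 0" by simp
  obtain t where "t \<in> Z" using Z_ne by blast
  \<comment> \<open>With the other coefficients zero, any single point of \<open>Z\<close> forces
    \<open>c j = 0\<close>.\<close>
  then have "c j * exp (l j * t) = 0"
    using insert.prems(4) insert(1,2) c0 by auto
  then show ?case using c0 by simp
qed

text \<open>\<open>Z\<close> already has the maximal number of zeros of a nontrivial sum with
  \<open>card I\<close> terms, so there is no sign change to the right of \<open>Z\<close>. The sign
  there is that of the term with the largest exponent, which dominates at infinity.\<close>

lemma exp_sum_pos:
  fixes l c :: "'a \<Rightarrow> real"
  assumes fin: "finite I" and inj: "inj_on l I" and Z: "finite Z" "card I = Suc (card Z)"
    and zero: "\<forall>t\<in>Z. (\<Sum>i\<in>I. c i * exp (l i * t)) = 0"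
    and j: "j \<in> I" "\<forall>i\<in>I. l i \<le> l j" "c j > 0" and s: "\<forall>t\<in>Z. t < s"
  shows "(\<Sum>i\<in>I. c i * exp (l i * s)) > 0"
proof -
  define f where "f t = (\<Sum>i\<in>I. c i * exp (l i * t))" for t
  have nz: "f t \<noteq> 0" if "t \<ge> s" for t
  proof
    assume "f t = 0"
    moreover have "t \<notin> Z" using s that by force
    ultimately have "\<forall>i\<in>I. c i = 0"
      using Z zero by (intro exp_sum_zeros[OF fin inj, of "insert t Z"]) (auto simp: f_def)
    then show False using j by auto
  qed
  have f_split: "f t = exp (l j * t) * (c j + (\<Sum>i\<in>I - {j}. c i * exp ((l i - l j) * t)))" for t
  proof -
    have "f t = c j * exp (l j * t) + (\<Sum>i\<in>I - {j}. c i * exp (l i * t))"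
      unfolding f_def using fin j(1) by (rule sum.remove)
    also have "(\<Sum>i\<in>I - {j}. c i * exp (l i * t))
        = exp (l j * t) * (\<Sum>i\<in>I - {j}. c i * exp ((l i - l j) * t))"
      unfolding sum_distrib_left
      by (intro sum.cong) (auto simp: algebra_simps exp_diff)
    finally show ?thesis by (simp add: algebra_simps)
  qed
  have "((\<lambda>t. c j + (\<Sum>i\<in>I - {j}. c i * exp ((l i - l j) * t)))
      \<longlongrightarrow> c j + (\<Sum>i\<in>I - {j}. c i * 0)) at_top"
  proof (intro tendsto_intros)
    fix i assume i: "i \<in> I - {j}"
    then have "l i - l j < 0" using j inj by (force simp: inj_on_def less_le)
    then have "filterlim (\<lambda>t. (l i - l j) * t) at_bot at_top"
      by (intro filterlim_tendsto_neg_mult_at_bot[OF tendsto_const _ filterlim_ident])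
    then show "((\<lambda>t. exp ((l i - l j) * t)) \<longlongrightarrow> 0) at_top"
      by (rule filterlim_compose[OF exp_at_bot])
  qed
  then have "\<forall>\<^sub>F t in at_top. c j + (\<Sum>i\<in>I - {j}. c i * exp ((l i - l j) * t)) > 0"
    by (rule order_tendstoD) (use j in simp)
  then have "\<forall>\<^sub>F t in at_top. t \<ge> s \<and> f t > 0"
    using eventually_ge_at_top[of s] by eventually_elim (simp add: f_split)
  then obtain T where T: "T \<ge> s" "f T > 0"
    by (metis (no_types, lifting) eventually_happens trivial_limit_at_top_linorder)
  have "continuous_on {s..T} f"
    unfolding f_def by (intro continuous_intros)
  then have "f s > 0"
    using IVT'[of f s 0 T] T nz by force
  then show ?thesis by (simp add: f_def)
qed

text \<open>The window start \<open>p\<close> is kept arbitrary because the induction uses the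
  windows starting at \<open>p\<close> and at \<open>Suc p\<close>. Taking \<open>p \<ge> 1\<close>
  makes every base \<open>i\<close> positive, so that \<open>ln\<close> applies.\<close>

lemma alternating_weights:
  assumes "finite E" "p \<ge> 1"
  shows "\<exists>w :: nat \<Rightarrow> real. (\<forall>i\<in>{p..p + card E}. w i > 0) \<and>
    (\<forall>e\<in>E. (\<Sum>i = p..p + card E. (-1) ^ i * w i * real i ^ e) = 0)"
  using assms
proof (induction E arbitrary: p rule: finite_linorder_max_induct)
  case empty
  show ?case by (intro exI[of _ "\<lambda>_. 1"]) simp
next
  case (insert d A)
  define k where "k = card A"
  have dA: "d \<notin> A" using insert by auto
  define S where "S q w e = (\<Sum>i = q..q + k. (-1) ^ i * w i * real i ^ e)"
    for q :: nat and w :: "nat \<Rightarrow> real" and e :: nat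
  \<comment> \<open>As a function of \<open>e\<close>, \<open>S q w e\<close> is an exponential sum
    with frequencies \<open>ln i\<close>: \<open>k + 1\<close> terms and the \<open>k\<close> zeros
    in \<open>A\<close>. As \<open>d\<close> exceeds all of \<open>A\<close>, its sign at
    \<open>d\<close> is that of the term for \<open>i = q + k\<close>.\<close>
  have sgn: "(-1) ^ (q + k) * S q w d > 0"
    if q: "q \<ge> 1" and w: "\<forall>i\<in>{q..q + k}. w i > 0" "\<forall>e\<in>A. S q w e = 0" for q w
  proof -
    let ?c = "\<lambda>i. (-1) ^ (q + k) * ((-1) ^ i * w i)"
    have powexp: "real i ^ e = exp (ln (real i) * real e)" if "i \<ge> 1" for i e
      using that by (simp add: exp_of_nat_mult mult.commute[of "ln _"])
    have eq: "(\<Sum>i = q..q + k. ?c i * exp (ln (real i) * real e)) = (-1) ^ (q + k) * S q w e" for e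
      unfolding S_def sum_distrib_left using q
      by (intro sum.cong) (auto simp: powexp)
    have "(\<Sum>i = q..q + k. ?c i * exp (ln (real i) * real d)) > 0"
    proof (rule exp_sum_pos)
      show "inj_on (\<lambda>i. ln (real i)) {q..q + k}"
        using q by (auto simp: inj_on_def)
      show "card {q..q + k} = Suc (card (real ` A))"
        by (simp add: card_image k_def)
      show "\<forall>t\<in>real ` A. (\<Sum>i = q..q + k. ?c i * exp (ln (real i) * t)) = 0"
        using w by (auto simp: eq)
      show "q + k \<in> {q..q + k}" by simp
      show "\<forall>i\<in>{q..q + k}. ln (real i) \<le> ln (real (q + k))" using q by auto
      show "?c (q + k) > 0" using w by (simp add: mult.assoc[symmetric] power_add[symmetric])
      show "\<forall>t\<in>real ` A. t < real d" using insert by auto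
    qed (use insert in auto)
    then show ?thesis by (simp add: eq)
  qed
  obtain u where u: "\<forall>i\<in>{p..p + k}. u i > 0" "\<forall>e\<in>A. S p u e = 0"
    using insert.IH[OF insert.prems] unfolding S_def k_def by blast
  obtain v where v: "\<forall>i\<in>{Suc p..Suc p + k}. v i > 0" "\<forall>e\<in>A. S (Suc p) v e = 0"
    using insert.IH[of "Suc p"] unfolding S_def k_def by auto
  \<comment> \<open>These are the absolute values of the two sums at \<open>d\<close>. Their signs
    are opposite for adjacent windows, so weighting each sum by the absolute value of the other
    makes them cancel.\<close>
  define \<alpha> where "\<alpha> = (-1) ^ (p + k) * S p u d"
  define \<beta> where "\<beta> = (-1) ^ (Suc p + k) * S (Suc p) v d"
  have pos: "\<alpha> > 0" "\<beta> > 0"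
    unfolding \<alpha>_def \<beta>_def using sgn[OF insert.prems u] sgn[OF _ v] by simp_all
  have cancel: "\<beta> * S p u d + \<alpha> * S (Suc p) v d = 0"
    unfolding \<alpha>_def \<beta>_def by simp
  define w where "w i = (if i \<le> p + k then \<beta> * u i else 0) + (if i \<ge> Suc p then \<alpha> * v i else 0)" for i
  have w_sum: "(\<Sum>i = p..Suc p + k. (-1) ^ i * w i * real i ^ e) = \<beta> * S p u e + \<alpha> * S (Suc p) v e" for e
  proof -
    have "(\<Sum>i = p..Suc p + k. (-1) ^ i * w i * real i ^ e)
        = (\<Sum>i = p..Suc p + k. if i \<le> p + k then \<beta> * ((-1) ^ i * u i * real i ^ e) else 0)
        + (\<Sum>i = p..Suc p + k. if i \<ge> Suc p then \<alpha> * ((-1) ^ i * v i * real i ^ e) else 0)"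
      unfolding sum.distrib[symmetric] by (intro sum.cong) (auto simp: w_def algebra_simps)
    also have "(\<Sum>i = p..Suc p + k. if i \<le> p + k then \<beta> * ((-1) ^ i * u i * real i ^ e) else 0)
        = \<beta> * S p u e"
      unfolding S_def sum_distrib_left by (intro sum.mono_neutral_cong_right) auto
    also have "(\<Sum>i = p..Suc p + k. if i \<ge> Suc p then \<alpha> * ((-1) ^ i * v i * real i ^ e) else 0)
        = \<alpha> * S (Suc p) v e"
      unfolding S_def sum_distrib_left by (intro sum.mono_neutral_cong_right) auto
    finally show ?thesis .
  qed
  have "w i > 0" if "i \<in> {p..Suc p + k}" for i
    using that u v pos by (auto simp: w_def intro!: add_pos_pos)
  then show ?case
    using u v cancel insert(1) dA w_sum
    by (intro exI[of _ w]) (auto simp: k_def)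
qed

text \<open>The exponent vectors \<open>\<mu> k\<close> need not be distinct: distinct monomials may become equal when
  a variable is eliminated.\<close>

lemma card_terms_ge_if_parity_signs:
  fixes c :: "'k \<Rightarrow> real" and \<mu> :: "'k \<Rightarrow> nat \<Rightarrow> nat"
  assumes "finite K" "m \<ge> 1"
    and "\<And>a :: nat \<Rightarrow> nat. (\<forall>i\<in>{1..n}. a i \<in> {1..m}) \<Longrightarrow>
      (-1) ^ (\<Sum>i = 1..n. a i) * (\<Sum>k\<in>K. c k * (\<Prod>i = 1..n. real (a i) ^ \<mu> k i)) > 0"
  shows "card K \<ge> n * (m - 1) + 1"
  using assms
proof (induction n arbitrary: K c)
  case 0
  have "K \<noteq> {}" using 0(3)[of "\<lambda>_. 1"] by auto
  then show ?case using 0 by (simp add: Suc_le_eq card_gt_0_iff)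
next
  case (Suc n)
  define X where "X = (\<lambda>k. \<mu> k (Suc n)) ` K"
  have fX: "finite X" using Suc.prems by (simp add: X_def)
  have "\<exists>E. finite E \<and> card E = m - 1 \<and> (E \<subseteq> X \<or> X \<subseteq> E)"
  proof (cases "m - 1 \<le> card X")
    case True
    then show ?thesis by (metis obtain_subset_with_card_n)
  next
    case False
    obtain B where "finite B" "card B = m - 1 - card X" "X \<inter> B = {}"
      using finite_arbitrarily_large_disj[OF infinite_UNIV_nat fX] by blast
    then show ?thesis using False fX
      by (intro exI[of _ "X \<union> B"]) (auto simp: card_Un_disjoint)
  qed
  then obtain E where E: "finite E" "card E = m - 1" "E \<subseteq> X \<or> X \<subseteq> E" by blast
  obtain w :: "nat \<Rightarrow> real" where w: "\<forall>b\<in>{1..m}. w b > 0"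
      "\<forall>e\<in>E. (\<Sum>b = 1..m. (-1) ^ b * w b * real b ^ e) = 0"
    using alternating_weights[OF E(1), of 1] E(2) Suc.prems(2) by auto
  define h where "h e = (\<Sum>b = 1..m. (-1) ^ b * w b * real b ^ e)" for e
  define D where "D = {k\<in>K. \<mu> k (Suc n) \<in> E}"
  \<comment> \<open>The terms in \<open>D\<close> vanish because \<open>h\<close> is zero on
    \<open>E\<close>. The others form a sum in \<open>n\<close> variables with coefficients
    \<open>c k * h (\<mu> k (Suc n))\<close>, to which the induction hypothesis applies.\<close>
  have rest: "n * (m - 1) + 1 \<le> card (K - D)"
  proof (rule Suc.IH)
    show "finite (K - D)" using Suc.prems by simp
    fix a :: "nat \<Rightarrow> nat" assume a: "\<forall>i\<in>{1..n}. a i \<in> {1..m}"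
    let ?M = "\<lambda>k. \<Prod>i = 1..n. real (a i) ^ \<mu> k i"
    let ?s = "(-1) ^ (\<Sum>i = 1..n. a i) :: real"
    have "(-1) ^ b * ?s * (\<Sum>k\<in>K. c k * (?M k * real b ^ \<mu> k (Suc n))) > 0" if "b \<in> {1..m}" for b
    proof -
      have "(\<Sum>i = 1..n. (a(Suc n := b)) i) = (\<Sum>i = 1..n. a i)"
        by (intro sum.cong) auto
      moreover have "(\<Prod>i = 1..n. real ((a(Suc n := b)) i) ^ \<mu> k i) = ?M k" for k
        by (intro prod.cong) auto
      moreover have "\<forall>i\<in>{1..Suc n}. (a(Suc n := b)) i \<in> {1..m}" using a that by auto
      ultimately show ?thesis
        using Suc.prems(3)[of "a(Suc n := b)"] 
        by (simp add: power_add del: fun_upd_apply) (simp add: mult_ac)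
    qed
    then have "(\<Sum>b = 1..m. w b * ((-1) ^ b * ?s * (\<Sum>k\<in>K. c k * (?M k * real b ^ \<mu> k (Suc n))))) > 0"
      using w Suc.prems(2) by (intro sum_pos) auto
    also have "(\<Sum>b = 1..m. w b * ((-1) ^ b * ?s * (\<Sum>k\<in>K. c k * (?M k * real b ^ \<mu> k (Suc n)))))
        = (\<Sum>b = 1..m. \<Sum>k\<in>K. ?s * (c k * ?M k * ((-1) ^ b * w b * real b ^ \<mu> k (Suc n))))"
      unfolding sum_distrib_left by (intro sum.cong) (auto simp: mult_ac)
    also have "\<dots> = ?s * (\<Sum>k\<in>K. c k * h (\<mu> k (Suc n)) * ?M k)"
      unfolding h_def sum_distrib_left sum_distrib_right
      by (subst sum.swap) (auto simp: mult_ac intro!: sum.cong)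
    also have "(\<Sum>k\<in>K. c k * h (\<mu> k (Suc n)) * ?M k) = (\<Sum>k\<in>K - D. c k * h (\<mu> k (Suc n)) * ?M k)"
      using Suc.prems(1) w(2) by (intro sum.mono_neutral_right) (auto simp: D_def h_def)
    finally show "?s * (\<Sum>k\<in>K - D. c k * h (\<mu> k (Suc n)) * ?M k) > 0" .
  qed (fact Suc.prems(2))
  \<comment> \<open>Were \<open>X \<subseteq> E\<close>, then \<open>D = K\<close>. So
    \<open>E \<subseteq> X\<close>: each of the \<open>m - 1\<close> exponents in \<open>E\<close>
    is attained by some index in \<open>D\<close>, whence \<open>card D \<ge> m - 1\<close>.\<close>
  have "K - D \<noteq> {}" using rest by (metis add_is_0 card.empty le_zero_eq one_neq_zero)
  then have "E \<subseteq> X" using E(3) by (auto simp: D_def X_def)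
  then have "E \<subseteq> (\<lambda>k. \<mu> k (Suc n)) ` D" by (auto simp: D_def X_def)
  moreover have fD: "finite D" "D \<subseteq> K" using Suc.prems(1) by (auto simp: D_def)
  ultimately have "m - 1 \<le> card D" using E(2) by (metis surj_card_le)
  moreover have "card K = card D + card (K - D)"
    using fD Suc.prems(1) by (metis card_Diff_subset card_mono le_add_diff_inverse)
  ultimately show ?case using rest by simp
qed

theorem theorem5p1:
  fixes m n :: nat and P :: rmpoly
  assumes "m \<ge> 1" and "n \<ge> 1"
    and "P \<in> poly_ring n"
    and "sign_represents P {1..int m} n (Par n)"
  shows "sparsity P \<ge> n * (m - 1) + 1"
  unfolding sparsity_def
proof (rule card_terms_ge_if_parity_signs[where c = "Poly_Mapping.lookup P"
      and \<mu> = Poly_Mapping.lookup])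
  fix a :: "nat \<Rightarrow> nat" assume a: "\<forall>i\<in>{1..n}. a i \<in> {1..m}"
  \<comment> \<open>The points of \<open>cube\<close> are extensional functions, hence the
    restriction.\<close>
  define a' where "a' = restrict (\<lambda>i. int (a i)) {1..n}"
  let ?v = "mpoly_eval P (\<lambda>i. real_of_int (a' i))"
  have "a' \<in> cube {1..int m} n"
    unfolding cube_def a'_def using a by fastforce
  then have sign: "Par n a' = 0 \<longrightarrow> ?v > 0" "Par n a' = 1 \<longrightarrow> ?v < 0"
    using assms(4) by (auto simp: sign_represents_def)
  \<comment> \<open>By \<open>poly_ring\<close> the product over the keys extends to all of
    \<open>{1..n}\<close>, the additional factors having exponent zero.\<close>
  have "monom_eval \<mu> (\<lambda>i. real_of_int (a' i)) = (\<Prod>i = 1..n. real (a i) ^ Poly_Mapping.lookup \<mu> i)"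
    if "\<mu> \<in> Poly_Mapping.keys P" for \<mu>
  proof -
    have "Poly_Mapping.keys \<mu> \<subseteq> {1..n}" using that assms(3) by (auto simp: poly_ring_def)
    then show ?thesis unfolding monom_eval_def
      by (intro prod.mono_neutral_cong_left) (auto simp: a'_def not_in_keys_iff_lookup_eq_zero)
  qed
  then have v: "?v = (\<Sum>k\<in>Poly_Mapping.keys P. Poly_Mapping.lookup P k *
      (\<Prod>i = 1..n. real (a i) ^ Poly_Mapping.lookup k i))"
    unfolding mpoly_eval_def by (intro sum.cong) auto
  have "(\<Sum>i = 1..n. a' i) = int (\<Sum>i = 1..n. a i)"
    unfolding a'_def by simp
  then have "Par n a' = int ((\<Sum>i = 1..n. a i) mod 2)"
    unfolding Par_def by (simp add: zmod_int)
  then have "(-1) ^ (\<Sum>i = 1..n. a i) * ?v > 0"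
    using sign by (cases "even (\<Sum>i = 1..n. a i)") (auto simp: even_iff_mod_2_eq_zero odd_iff_mod_2_eq_one)
  then show "(-1) ^ (\<Sum>i = 1..n. a i) * (\<Sum>k\<in>Poly_Mapping.keys P. Poly_Mapping.lookup P k *
      (\<Prod>i = 1..n. real (a i) ^ Poly_Mapping.lookup k i)) > 0"
    by (simp only: v)
qed (use assms(1) in auto)

end
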